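(* Let $H,K\in\mathcal T$. The following statements are equivalent. (a) $H$ and $K$ have the same list of principal minors, i.e., $\det(H_J)=\det(K_J)$ for all $J\subseteq[N]$. (b) $H_{i,i}=K_{i,i}$ for all $i\in[N]$ and $|H_{i,j}|=|K_{i,j}|$ for all $i,j\in[N]$ with $i\neq j$; $H$ and $K$ have the same signed adjacency graph; and, for all cycles $C$ in that graph, $\pi_K(C)=\pi_H(C)$.
   Context: $[N]=\{1,\dots,N\}$. For an $N\times N$ matrix $M$ and $J\subseteq[N]$, $M_J=(M_{i,j})_{i,j\in J}$. $\mathcal T$ is the set of signed kernels: real $N\times N$ matrices $M$ such that for all $i\neq j$, $M_{j,i}=\epsilon_{i,j}M_{i,j}$ for some $\epsilon_{i,j}=\epsilon_{j,i}\in\{-1,1\}$. The adjacency graph $G_M$ of $M\in\mathcal T$ is the undirected graph on $[N]$ in which $\{i,j\}$ ($i\neq j$) is an edge iff $M_{i,j}\neq 0$. The signed adjacency graph is $G_M$ together with the sign $\epsilon_{i,j}=M_{j,i}/M_{i,j}\in\{-1,1\}$ assigned to each edge $\{i,j\}$. Cycles are simple cycles with at least $3$ vertices, identified with their edge sets. A traveling of a cycle $C$ of a graph $G$ is an oriented cycle of $G$ whose vertex set coincides with that of $C$ (it need not use the edges of $C$); the set of travelings of $C$ is denoted $\mathbb T(C)$, and a traveling is identified with its set of oriented edges. For $M\in\mathcal T$ and a cycle $C$ in $G_M$, $$\pi_M(C)=\sum_{\overrightarrow{C}\in\mathbb T(C)}\ \prod_{(i,j)\in\overrightarrow{C}}M_{i,j}.$$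 *)

theory Defs
  imports "Jordan_Normal_Form.Determinant" "Jordan_Normal_Form.DL_Submatrix"
begin

text \<open>
  Matrices are indexed from 0, so the index set $[N]$ is \<open>{..<N}\<close>.  For \<open>J \<subseteq> {..<N}\<close> the
  principal submatrix $M_J$ is \<open>submatrix M J J\<close>, with the indices in increasing order.
\<close>

definition signed_kernels :: "nat \<Rightarrow> real mat set" where
  "signed_kernels N = {M \<in> carrier_mat N N.
     \<exists>\<epsilon> :: nat \<Rightarrow> nat \<Rightarrow> real. \<forall>i<N. \<forall>j<N. i \<noteq> j \<longrightarrow>
       \<epsilon> i j \<in> {-1, 1} \<and> \<epsilon> i j = \<epsilon> j i \<and> M $$ (j, i) = \<epsilon> i j * M $$ (i, j)}"

text \<open>An undirected graph is a pair of a vertex set and a set of two-element edges.\<close>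

type_synonym 'a graph = "'a set \<times> 'a set set"

definition adjacency_graph :: "real mat \<Rightarrow> nat graph" where
  "adjacency_graph M =
     ({..<dim_row M},
      {{i, j} | i j. i < dim_row M \<and> j < dim_row M \<and> i \<noteq> j \<and> M $$ (i, j) \<noteq> 0})"

text \<open>
  The sign assignment on the edges is given by its graph, a set of pairs (edge, sign).  On a signed
  kernel it is a function: $M_{j,i}/M_{i,j} = M_{i,j}/M_{j,i}$ for every edge.
\<close>

definition edge_signs :: "real mat \<Rightarrow> (nat set \<times> real) set" where
  "edge_signs M =
     {({i, j}, M $$ (j, i) / M $$ (i, j)) | i j.
        i < dim_row M \<and> j < dim_row M \<and> i \<noteq> j \<and> M $$ (i, j) \<noteq> 0}"

definition signed_adjacency_graph :: "real mat \<Rightarrow> nat graph \<times> (nat set \<times> real) set" where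
  "signed_adjacency_graph M = (adjacency_graph M, edge_signs M)"

text \<open>
  The distinct vertices \<open>vs\<close> are visited in the given cyclic order.  Oriented cycles are identified
  with their sets of arcs and cycles with their sets of edges, so that lists which differ by a
  rotation (or, for cycles, a reversal) denote the same object.
\<close>

definition cyclic_arcs :: "'a list \<Rightarrow> ('a \<times> 'a) set" where
  "cyclic_arcs vs = {(vs ! k, vs ! (Suc k mod length vs)) | k. k < length vs}"

definition oriented_cycles :: "'a graph \<Rightarrow> ('a \<times> 'a) set set" where
  "oriented_cycles G = {cyclic_arcs vs | vs.
     distinct vs \<and> 3 \<le> length vs \<and> set vs \<subseteq> fst G \<and>
     (\<forall>(i, j) \<in> cyclic_arcs vs. {i, j} \<in> snd G)}"

definition cycles :: "'a graph \<Rightarrow> 'a set set set" where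
  "cycles G = (\<lambda>A. {{i, j} | i j. (i, j) \<in> A}) ` oriented_cycles G"

text \<open>\<open>Field A\<close> and \<open>\<Union>C\<close> are the vertex sets of the oriented cycle \<open>A\<close> and of the cycle \<open>C\<close>.\<close>

definition travelings :: "'a graph \<Rightarrow> 'a set set \<Rightarrow> ('a \<times> 'a) set set" where
  "travelings G C = {A \<in> oriented_cycles G. Field A = \<Union>C}"

definition cycle_sum :: "real mat \<Rightarrow> nat set set \<Rightarrow> real" where
  "cycle_sum M C = (\<Sum>A \<in> travelings (adjacency_graph M) C. \<Prod>(i, j) \<in> A. M $$ (i, j))"

end

theory Submission
  imports Defs "HOL-Combinatorics.Orbits" "HOL-Combinatorics.Cycles"
begin

text \<open>
  Write $c_M(J)$ for the sum of $\prod_{i \in J} M_{i, p(i)}$ over the permutations $p$ of $J$ that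
  consist of a single cycle.  The principal minors of any matrix and the numbers $c_M(J)$ determine
  each other.  Indeed, fix $v \in J$ and sort the permutations of $J$ in the Leibniz formula by the
  orbit $B$ of $v$; such a permutation is a single cycle on $B$, of sign $(-1)^{|B|-1}$, times an
  arbitrary permutation of $J \setminus B$, so that
  \[ \det M_J = \sum_{v \in B \subseteq J} (-1)^{|B|-1}\, c_M(B) \det M_{J \setminus B}. \]
  This is \<open>permutation_minor_expand\<close>.  The term $B = J$ contains $c_M(J)$ with coefficient $\pm 1$ and
  the other terms only involve proper subsets of $J$, so an induction shows that two matrices have
  the same principal minors iff they have the same cyclic sums
  (\<open>permutation_minors_eq_iff_cyclic_sums_eq\<close>).

  The theorem follows by reading off what equality of the cyclic sums says for each size of $J$.
  For $J = \{i\}$ it is equality of the diagonals.  For $J = \{i, j\}$ it is equality of the products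
  $M_{i,j} M_{j,i} = \epsilon_{i,j} M_{i,j}^2$, which for signed kernels amounts to equality of the
  absolute values and of the signed adjacency graphs (\<open>signed_kernel_abs_from_products\<close>,
  \<open>signed_adjacency_graph_eq_iff\<close>).  For $|J| \ge 3$ the single-cycle permutations of $J$ with a
  nonzero product are exactly the oriented cycles through all of $J$ along nonzero entries, so
  $c_M(J) = \pi_M(C)$ for every cycle $C$ with vertex set $J$, and $c_M(J) = 0$ if there is
  no such cycle (\<open>cyclic_sum_eq_sum_oriented_cycles\<close>, \<open>cycle_sums_eq_iff_cyclic_sums_eq\<close>).
\<close>

section \<open>Principal minors by the Leibniz formula\<close>

text \<open>
  The Leibniz formula makes sense over an unordered finite index set, because the sign of a
  permutation does not depend on an enumeration of the indices.
\<close>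

definition permutation_minor :: "('a \<Rightarrow> 'a \<Rightarrow> 'b::comm_ring_1) \<Rightarrow> 'a set \<Rightarrow> 'b" where
  "permutation_minor f J = (\<Sum>p | p permutes J. of_int (sign p) * (\<Prod>i\<in>J. f i (p i)))"

lemma permutation_minor_empty [simp]: "permutation_minor f {} = 1"
  by (simp add: permutation_minor_def)

lemma bij_betw_pick:
  assumes "finite J"
  shows "bij_betw (pick J) {0..<card J} J"
proof -
  have inj: "inj_on (pick J) {0..<card J}"
    by (rule inj_onI) (metis atLeastLessThan_iff card_pick_le)
  have "pick J ` {0..<card J} \<subseteq> J"
    by (auto intro: pick_in_set_le)
  moreover have "card (pick J ` {0..<card J}) = card J"
    by (simp add: card_image[OF inj])
  ultimately show ?thesis
    using inj assms by (simp add: bij_betw_def card_subset_eq)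
qed

text \<open>
  Transport of permutations along a bijection preserves signs.  Here it removes the renumbering
  of the chosen indices that is built into \<open>submatrix\<close>.
\<close>

lemma permutation_minor_reindex:
  assumes "bij_betw h A B" "finite A"
  shows "permutation_minor f B = permutation_minor (\<lambda>i j. f (h i) (h j)) A"
proof -
  have inj: "inj_on h A" and im: "h ` A = B"
    using assms(1) by (auto simp: bij_betw_def)
  have "permutation_minor f B =
     (\<Sum>p | p permutes A. of_int (sign (map_permutation A h p)) * (\<Prod>i\<in>B. f i (map_permutation A h p i)))"
    unfolding permutation_minor_def
    by (rule sum.reindex_bij_betw[symmetric])
       (unfold map_permutation_def restrict_id_def im o_def, rule bij_betw_permutations[OF assms(1)])
  also have "\<dots> = permutation_minor (\<lambda>i j. f (h i) (h j)) A"
    unfolding permutation_minor_def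
  proof (rule sum.cong, simp)
    fix p assume "p \<in> {p. p permutes A}"
    then have p: "p permutes A" by simp
    have "(\<Prod>i\<in>B. f i (map_permutation A h p i)) = (\<Prod>i\<in>A. f (h i) (map_permutation A h p (h i)))"
      using inj by (simp add: im[symmetric] prod.reindex)
    also have "\<dots> = (\<Prod>i\<in>A. f (h i) (h (p i)))"
      by (rule prod.cong) (use inj in \<open>auto simp: map_permutation_apply\<close>)
    finally show "of_int (sign (map_permutation A h p)) * (\<Prod>i\<in>B. f i (map_permutation A h p i)) =
        of_int (sign p) * (\<Prod>i\<in>A. f (h i) (h (p i)))"
      using sign_map_permutation[OF inj p assms(2)] by simp
  qed
  finally show ?thesis .
qed

lemma det_principal_submatrix:
  assumes "M \<in> carrier_mat N N" "J \<subseteq> {..<N}"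
  shows "det (submatrix M J J) = permutation_minor (\<lambda>i j. M $$ (i, j)) J"
proof -
  have fin: "finite J" using assms(2) finite_subset by blast
  have eq: "{i. i < N \<and> i \<in> J} = J" using assms(2) by auto
  have "det (submatrix M J J) =
      permutation_minor (\<lambda>i j. submatrix M J J $$ (i, j)) {0..<card J}"
    using assms(1) eq by (simp add: det_def dim_submatrix permutation_minor_def)
  also have "\<dots> = permutation_minor (\<lambda>i j. M $$ (pick J i, pick J j)) {0..<card J}"
    unfolding permutation_minor_def
    using assms(1) eq
    by (intro sum.cong prod.cong refl arg_cong2[where f = times])
       (auto simp: submatrix_def dest: permutes_in_image)
  also have "\<dots> = permutation_minor (\<lambda>i j. M $$ (i, j)) J"
    by (rule permutation_minor_reindex[OF bij_betw_pick[OF fin], symmetric]) simp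
  finally show ?thesis .
qed

section \<open>Cyclic permutations of a finite set\<close>

definition cyclic_perms :: "'a set \<Rightarrow> ('a \<Rightarrow> 'a) set" where
  "cyclic_perms J = {p. p permutes J \<and> cyclic_on p J}"

text \<open>The signs are left out: they are the same for all cyclic permutations of a finite \<open>J\<close>.\<close>

definition cyclic_sum :: "('a \<Rightarrow> 'a \<Rightarrow> 'b::comm_ring_1) \<Rightarrow> 'a set \<Rightarrow> 'b" where
  "cyclic_sum f J = (\<Sum>p\<in>cyclic_perms J. \<Prod>i\<in>J. f i (p i))"

lemma cycle_of_list_nth:
  assumes "distinct vs" "k < length vs"
  shows "cycle_of_list vs (vs ! k) = vs ! (Suc k mod length vs)"
proof -
  have "map (cycle_of_list vs) vs = rotate1 vs"
    using cyclic_rotation[OF assms(1), of 1] by simp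
  then have "map (cycle_of_list vs) vs ! k = rotate1 vs ! k" by simp
  then show ?thesis using assms(2) by (simp add: nth_rotate1)
qed

text \<open>A cycle through $n$ points is a product of $n - 1$ transpositions.\<close>

lemma sign_cycle_of_list:
  "distinct vs \<Longrightarrow> sign (cycle_of_list vs) = (-1) ^ (length vs - 1)"
proof (induction vs rule: cycle_of_list.induct)
  case (1 i j cs)
  have "sign (cycle_of_list (i # j # cs)) = sign (transpose i j) * sign (cycle_of_list (j # cs))"
    unfolding cycle_of_list.simps(1)
    by (rule sign_compose[OF permutation_swap_id permutation_of_cycle])
  then show ?case using 1 by (simp add: sign_swap_id del: cycle_of_list.simps)
qed simp_all

text \<open>
  This links the orbit description, which suits the decomposition of permutations, with the
  list description, which gives signs and arcs: enumerate \<open>J\<close> along the powers of the permutation.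
  For empty \<open>J\<close> it fails, as the identity comes from the empty list but \<open>cyclic_on\<close> asks for a point of \<open>J\<close>.
\<close>

lemma cyclic_perms_eq_cycles_of_lists:
  assumes "finite J" "J \<noteq> {}"
  shows "cyclic_perms J = cycle_of_list ` {vs. distinct vs \<and> set vs = J}"
proof (intro Set.set_eqI iffI)
  fix p assume "p \<in> cyclic_perms J"
  then have p: "p permutes J" and cyc: "cyclic_on p J" by (auto simp: cyclic_perms_def)
  have perm: "permutation p" using p assms(1) permutation_permutes by blast
  obtain s where s: "s \<in> J" "J = orbit p s" using cyc by (auto simp: cyclic_on_def)
  let ?vs = "support p s"
  have set: "set ?vs = J"
    unfolding support_set[OF perm] s(2) orbit_altdef_permutation[OF perm] by auto
  have "p x = cycle_of_list ?vs x" for x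
  proof (cases "x \<in> J")
    case True
    then show ?thesis using cycle_restrict[OF perm] set by blast
  next
    case False
    then show ?thesis using p set id_outside_supp[of x ?vs] by (metis permutes_not_in)
  qed
  then have "p = cycle_of_list ?vs" by blast
  then show "p \<in> cycle_of_list ` {vs. distinct vs \<and> set vs = J}"
    using cycle_of_permutation[OF perm, of s] set by blast
next
  fix p assume "p \<in> cycle_of_list ` {vs. distinct vs \<and> set vs = J}"
  then obtain vs where vs: "distinct vs" "set vs = J" "p = cycle_of_list vs" by auto
  have ne: "vs \<noteq> []" using vs assms by auto
  have perm: "permutation p" using vs permutation_of_cycle by blast
  have pow: "(p ^^ n) (vs ! 0) = vs ! (n mod length vs)" for n
  proof -
    have "map (p ^^ n) vs ! 0 = rotate n vs ! 0"
      using cyclic_rotation[OF vs(1), of n] vs(3) by simp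
    then show ?thesis using ne by (simp add: nth_rotate)
  qed
  have "orbit p (vs ! 0) = J"
  proof -
    have "orbit p (vs ! 0) = {vs ! (n mod length vs) |n. True}"
      by (simp add: orbit_altdef_permutation[OF perm] pow)
    also have "\<dots> = set vs"
      using ne by (auto simp: set_conv_nth) (metis mod_less)
    finally show ?thesis using vs by simp
  qed
  moreover have "vs ! 0 \<in> J" using ne vs by auto
  ultimately have "cyclic_on p J" by (metis cyclic_on_singleI)
  then show "p \<in> cyclic_perms J"
    using vs cycle_permutes[of vs] by (simp add: cyclic_perms_def)
qed

lemma finite_cyclic_perms: "finite J \<Longrightarrow> finite (cyclic_perms J)"
  by (rule finite_subset[OF _ finite_permutations[of J]]) (auto simp: cyclic_perms_def)

lemma sign_cyclic_perm:
  assumes "finite J" "J \<noteq> {}" "p \<in> cyclic_perms J"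
  shows "sign p = (-1) ^ (card J - 1)"
  using assms by (auto simp: cyclic_perms_eq_cycles_of_lists sign_cycle_of_list distinct_card[symmetric])

lemma cyclic_sum_singleton: "cyclic_sum f {i} = f i i"
proof -
  have "vs = [i]" if "distinct vs" "set vs = {i}" for vs
  proof -
    have "length vs = 1" using that distinct_card[of vs] by simp
    then obtain a where "vs = [a]" by (auto simp: length_Suc_conv)
    then show ?thesis using that(2) by simp
  qed
  then have "{vs. distinct vs \<and> set vs = {i}} = {[i]}" by auto
  then show ?thesis by (simp add: cyclic_sum_def cyclic_perms_eq_cycles_of_lists)
qed

lemma cyclic_sum_pair:
  assumes "i \<noteq> j"
  shows "cyclic_sum f {i, j} = f i j * f j i"
proof -
  have "vs = [i, j] \<or> vs = [j, i]" if "distinct vs" "set vs = {i, j}" for vs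
  proof -
    have "length vs = 2" using that assms distinct_card[of vs] by simp
    then obtain a b where "vs = [a, b]" by (auto simp: length_Suc_conv numeral_2_eq_2)
    then show ?thesis using that by (auto simp: doubleton_eq_iff)
  qed
  then have "{vs. distinct vs \<and> set vs = {i, j}} = {[i, j], [j, i]}"
    using assms by auto
  then have "cyclic_perms {i, j} = {transpose i j}"
    by (simp add: cyclic_perms_eq_cycles_of_lists transpose_commute[of j i])
  then show ?thesis using assms by (simp add: cyclic_sum_def)
qed

section \<open>Principal minors and cyclic sums determine each other\<close>

lemma perm_restrict_orbit_cyclic_perms:
  assumes fin: "finite J" and p: "p permutes J"
  shows "perm_restrict p (orbit p v) \<in> cyclic_perms (orbit p v)"
proof -
  have cyc: "cyclic_on p (orbit p v)" by (rule cyclic_on_orbit[OF p fin])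
  have "inj_on p (orbit p v)" using permutes_inj[OF p] inj_on_subset by blast
  moreover have "p ` orbit p v \<subseteq> orbit p v" using cyclic_on_inI[OF cyc] by auto
  ultimately have "bij_betw p (orbit p v) (orbit p v)"
    using finite_cyclic_on[OF cyc] by (simp add: bij_betw_def endo_inj_surj)
  then have "bij_betw (perm_restrict p (orbit p v)) (orbit p v) (orbit p v)"
    by (subst bij_betw_cong[where g = p]) (simp_all add: perm_restrict_simps)
  then have "perm_restrict p (orbit p v) permutes orbit p v"
    by (rule bij_imp_permutes) (simp add: perm_restrict_simps)
  then show ?thesis
    using cyc by (simp add: cyclic_perms_def cyclic_on_perm_restrict)
qed

lemma comp_disjoint_perms_apply:
  assumes "c permutes B" "q permutes (J - B)"
  shows "(c \<circ> q) x = (if x \<in> B then c x else q x)"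
proof (cases "x \<in> B")
  case True
  then show ?thesis using permutes_not_in[OF assms(2), of x] by simp
next
  case False
  then have "q x \<notin> B"
    using permutes_in_image[OF assms(2), of x] permutes_not_in[OF assms(2), of x] by auto
  then show ?thesis using False permutes_not_in[OF assms(1)] by simp
qed

text \<open>
  The map $p \mapsto (B, p|_B, p|_{J \setminus B})$, where $B$ is the orbit of $v$, is a bijection from
  the permutations of $J$ onto the triples of a set $B$ with $v \in B \subseteq J$, a cyclic permutation of
  $B$ and a permutation of $J \setminus B$; its inverse is composition.  Signs and products are
  multiplicative along it.
\<close>

lemma permutation_minor_expand:
  assumes fin: "finite J" and v: "v \<in> J"
  shows "permutation_minor f J =
    (\<Sum>B | v \<in> B \<and> B \<subseteq> J. (-1) ^ (card B - 1) * cyclic_sum f B * permutation_minor f (J - B))"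
proof -
  let ?Bs = "{B. v \<in> B \<and> B \<subseteq> J}"
  let ?Q = "\<lambda>B. {q. q permutes (J - B)}"
  let ?t = "\<lambda>A p. \<Prod>i\<in>A. f i (p i)"
  have finB: "finite B" if "B \<in> ?Bs" for B
    using that fin finite_subset by blast
  have "(\<Sum>(B, c, q)\<in>(SIGMA B:?Bs. cyclic_perms B \<times> ?Q B).
      (-1) ^ (card B - 1) * ?t B c * (of_int (sign q) * ?t (J - B) q)) =
    (\<Sum>p | p permutes J. of_int (sign p) * ?t J p)"
  proof (rule sum.reindex_bij_witness[where
        i = "\<lambda>p. (orbit p v, perm_restrict p (orbit p v), perm_restrict p (J - orbit p v))"
        and j = "\<lambda>(B, c, q). c \<circ> q"], goal_cases)
    case (1 b)
    obtain B c q where b: "b = (B, c, q)" by (cases b)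
    have B: "v \<in> B" "B \<subseteq> J" and c: "c permutes B" "cyclic_on c B" and q: "q permutes (J - B)"
      using 1 b by (auto simp: cyclic_perms_def)
    note cq = comp_disjoint_perms_apply[OF c(1) q]
    have "cyclic_on (c \<circ> q) B"
      using c(2) cq by (simp cong: cyclic_cong del: o_apply)
    then have orb: "orbit (c \<circ> q) v = B" using B(1) by (rule orbit_cyclic_eq3)
    have "perm_restrict (c \<circ> q) B = c" "perm_restrict (c \<circ> q) (J - B) = q"
      using permutes_not_in[OF c(1)] permutes_not_in[OF q]
      by (auto simp: fun_eq_iff perm_restrict_def cq simp del: o_apply)
    then show ?case by (simp only: b case_prod_conv orb)
  next
    case (2 b)
    obtain B c q where b: "b = (B, c, q)" by (cases b)
    have "B \<subseteq> J" "c permutes B" "q permutes (J - B)"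
      using 2 b by (auto simp: cyclic_perms_def)
    then have "c \<circ> q permutes J"
      by (intro permutes_compose) (auto intro: permutes_subset)
    then show ?case by (simp only: b case_prod_conv mem_Collect_eq)
  next
    case (3 p)
    then have p: "p permutes J" by simp
    have cyc: "cyclic_on p (orbit p v)" by (rule cyclic_on_orbit[OF p fin])
    have c: "perm_restrict p (orbit p v) permutes orbit p v"
      using perm_restrict_orbit_cyclic_perms[OF fin p] by (simp add: cyclic_perms_def)
    note q = perm_restrict_diff_cyclic[OF p cyc]
    show ?case
      using permutes_not_in[OF p]
      by (auto simp: fun_eq_iff comp_disjoint_perms_apply[OF c q] perm_restrict_def simp del: o_apply)
  next
    case (4 p)
    then have p: "p permutes J" by simp
    have "v \<in> orbit p v"
      using p fin permutation_permutes permutation_self_in_orbit by metis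
    then show ?case
      using perm_restrict_diff_cyclic[OF p cyclic_on_orbit[OF p fin]]
        permutes_orbit_subset[OF p v] perm_restrict_orbit_cyclic_perms[OF fin p]
      by simp
  next
    case (5 b)
    obtain B c q where b: "b = (B, c, q)" by (cases b)
    have B: "v \<in> B" "B \<subseteq> J" and c: "c \<in> cyclic_perms B" "c permutes B" and q: "q permutes (J - B)"
      using 5 b by (auto simp: cyclic_perms_def)
    have fB: "finite B" using B fin finite_subset by blast
    note cq = comp_disjoint_perms_apply[OF c(2) q]
    have "permutation c" "permutation q"
      using c(2) q fB fin permutation_permutes finite_Diff by metis+
    then have sign: "sign (c \<circ> q) = (-1) ^ (card B - 1) * sign q"
      using sign_cyclic_perm[OF fB _ c(1)] B by (auto simp: sign_compose)
    have "?t J (c \<circ> q) = ?t (J - B) (c \<circ> q) * ?t B (c \<circ> q)"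
      by (rule prod.subset_diff[OF B(2) fin])
    also have "\<dots> = ?t (J - B) q * ?t B c"
      by (intro arg_cong2[where f = times] prod.cong refl) (auto simp: cq simp del: o_apply)
    finally show ?case
      unfolding b case_prod_conv sign by (simp add: mult_ac)
  qed
  then have "permutation_minor f J = (\<Sum>(B, c, q)\<in>(SIGMA B:?Bs. cyclic_perms B \<times> ?Q B).
      (-1) ^ (card B - 1) * ?t B c * (of_int (sign q) * ?t (J - B) q))"
    by (simp only: permutation_minor_def)
  also have "\<dots> = (\<Sum>B\<in>?Bs. \<Sum>(c, q)\<in>cyclic_perms B \<times> ?Q B.
      (-1) ^ (card B - 1) * ?t B c * (of_int (sign q) * ?t (J - B) q))"
    using fin finB by (intro sum.Sigma[symmetric])
      (auto intro!: finite_cyclic_perms finite_permutations intro: finite_subset[OF _ finite_Pow_iff[THEN iffD2, OF fin]])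
  also have "\<dots> = (\<Sum>B\<in>?Bs. (-1) ^ (card B - 1) * cyclic_sum f B * permutation_minor f (J - B))"
  proof (rule sum.cong, simp)
    fix B assume "B \<in> ?Bs"
    show "(\<Sum>(c, q)\<in>cyclic_perms B \<times> ?Q B.
        (-1) ^ (card B - 1) * ?t B c * (of_int (sign q) * ?t (J - B) q)) =
      (-1) ^ (card B - 1) * cyclic_sum f B * permutation_minor f (J - B)"
      unfolding cyclic_sum_def permutation_minor_def
      by (simp only: sum.cartesian_product[symmetric] sum_product mult.assoc sum_distrib_left[of "(-1) ^ (card B - 1)"])
  qed
  finally show ?thesis .
qed

text \<open>
  Both directions are inductions over subsets with the expansion above, at an arbitrary \<open>v \<in> J\<close>.
  From minors to cyclic sums, the unknown \<open>cyclic_sum f J\<close> occurs only in the term \<open>B = J\<close>, with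
  coefficient $\pm 1$, since the empty minor is 1.
\<close>

theorem permutation_minors_eq_iff_cyclic_sums_eq:
  assumes "finite S"
  shows "(\<forall>J\<subseteq>S. permutation_minor f J = permutation_minor g J) \<longleftrightarrow>
    (\<forall>J\<subseteq>S. J \<noteq> {} \<longrightarrow> cyclic_sum f J = cyclic_sum g J)" (is "?minors \<longleftrightarrow> ?sums")
proof
  assume minors: ?minors
  have "cyclic_sum f J = cyclic_sum g J" if "finite J" "J \<subseteq> S" "J \<noteq> {}" for J
    using that
  proof (induction J rule: finite_psubset_induct)
    case (psubset J)
    then obtain v where v: "v \<in> J" by blast
    let ?t = "\<lambda>f B. (-1) ^ (card B - 1) * cyclic_sum f B * permutation_minor f (J - B)"
    have fin: "finite {B. v \<in> B \<and> B \<subseteq> J}" using \<open>finite J\<close> by simp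
    have split: "permutation_minor h J = ?t h J + (\<Sum>B\<in>{B. v \<in> B \<and> B \<subseteq> J} - {J}. ?t h B)" for h
      using permutation_minor_expand[OF \<open>finite J\<close> v, of h] v sum.remove[OF fin, of J "?t h"] by simp
    have "(\<Sum>B\<in>{B. v \<in> B \<and> B \<subseteq> J} - {J}. ?t f B) = (\<Sum>B\<in>{B. v \<in> B \<and> B \<subseteq> J} - {J}. ?t g B)"
    proof (rule sum.cong, simp)
      fix B assume B: "B \<in> {B. v \<in> B \<and> B \<subseteq> J} - {J}"
      then have "cyclic_sum f B = cyclic_sum g B" using psubset by blast
      moreover have "permutation_minor f (J - B) = permutation_minor g (J - B)"
        using minors psubset.prems by blast
      ultimately show "?t f B = ?t g B" by simp
    qed
    then have "?t f J = ?t g J"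
      using split[of f] split[of g] minors psubset.prems by auto
    \<comment> \<open>Multiply by the sign once more; its square is 1 in every ring.\<close>
    then have "(-1) ^ (card J - 1) * ((-1) ^ (card J - 1) * cyclic_sum f J) =
        (-1) ^ (card J - 1) * ((-1) ^ (card J - 1) * cyclic_sum g J)" by simp
    then show ?case by (simp add: mult.assoc[symmetric] power_add[symmetric])
  qed
  then show ?sums using assms finite_subset by blast
next
  assume sums: ?sums
  have "permutation_minor f J = permutation_minor g J" if "finite J" "J \<subseteq> S" for J
    using that
  proof (induction J rule: finite_psubset_induct)
    case (psubset J)
    show ?case
    proof (cases "J = {}")
      case False
      then obtain v where v: "v \<in> J" by blast
      show ?thesis
        unfolding permutation_minor_expand[OF \<open>finite J\<close> v]
      proof (rule sum.cong, simp)
        fix B assume "B \<in> {B. v \<in> B \<and> B \<subseteq> J}"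
        then have "B \<subseteq> S" "B \<noteq> {}" "J - B \<subset> J" "J - B \<subseteq> S" using psubset.prems by auto
        then show "(-1) ^ (card B - 1) * cyclic_sum f B * permutation_minor f (J - B) =
            (-1) ^ (card B - 1) * cyclic_sum g B * permutation_minor g (J - B)"
          using sums psubset.IH by simp
      qed
    qed simp
  qed
  then show ?minors using assms finite_subset by blast
qed

section \<open>Cyclic permutations as oriented cycles\<close>

definition perm_arcs :: "'a set \<Rightarrow> ('a \<Rightarrow> 'a) \<Rightarrow> ('a \<times> 'a) set" where
  "perm_arcs J p = (\<lambda>i. (i, p i)) ` J"

lemma perm_arcs_cycle_of_list:
  assumes "distinct vs"
  shows "perm_arcs (set vs) (cycle_of_list vs) = cyclic_arcs vs"
proof -
  have "perm_arcs (set vs) (cycle_of_list vs) = (\<lambda>k. (vs ! k, cycle_of_list vs (vs ! k))) ` {..<length vs}"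
    by (auto simp: perm_arcs_def set_conv_nth)
  also have "\<dots> = cyclic_arcs vs"
    using cycle_of_list_nth[OF assms] by (auto simp: cyclic_arcs_def)
  finally show ?thesis .
qed

lemma Field_perm_arcs: "p permutes J \<Longrightarrow> Field (perm_arcs J p) = J"
  using permutes_in_image[of p J] by (auto simp: perm_arcs_def Field_def Domain_fst image_image Range_snd)

lemma Field_cyclic_arcs: "distinct vs \<Longrightarrow> Field (cyclic_arcs vs) = set vs"
  using Field_perm_arcs[OF cycle_permutes[of vs]] perm_arcs_cycle_of_list by metis

lemma inj_on_perm_arcs: "inj_on (perm_arcs J) (cyclic_perms J)"
proof (rule inj_onI)
  fix p q assume "p \<in> cyclic_perms J" "q \<in> cyclic_perms J" "perm_arcs J p = perm_arcs J q"
  then have "p permutes J" "q permutes J" "\<forall>i\<in>J. p i = q i"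
    by (auto simp: cyclic_perms_def perm_arcs_def)
  then show "p = q" by (metis ext permutes_not_in)
qed

text \<open>
  At least three vertices are needed: the cyclic permutation of two points traverses one
  edge twice and is not an oriented cycle.
\<close>

lemma oriented_cycles_on_vertex_set:
  assumes J: "J \<subseteq> fst G" "3 \<le> card J"
  shows "{A \<in> oriented_cycles G. Field A = J} =
    perm_arcs J ` {p \<in> cyclic_perms J. \<forall>i\<in>J. {i, p i} \<in> snd G}"
proof -
  have fin: "finite J" and ne: "J \<noteq> {}" using J(2) card_ge_0_finite[of J] by auto
  have edges: "(\<forall>(i, j)\<in>perm_arcs J p. {i, j} \<in> snd G) \<longleftrightarrow> (\<forall>i\<in>J. {i, p i} \<in> snd G)" for p
    by (auto simp: perm_arcs_def)
  show ?thesis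
  proof (intro Set.set_eqI iffI)
    fix A assume "A \<in> {A \<in> oriented_cycles G. Field A = J}"
    then obtain vs where vs: "A = cyclic_arcs vs" "distinct vs" "set vs = J"
      and e: "\<forall>(i, j)\<in>A. {i, j} \<in> snd G"
      by (auto simp: oriented_cycles_def Field_cyclic_arcs)
    then have A: "A = perm_arcs J (cycle_of_list vs)" by (metis perm_arcs_cycle_of_list)
    then show "A \<in> perm_arcs J ` {p \<in> cyclic_perms J. \<forall>i\<in>J. {i, p i} \<in> snd G}"
      using e vs by (auto simp: edges cyclic_perms_eq_cycles_of_lists[OF fin ne])
  next
    fix A assume "A \<in> perm_arcs J ` {p \<in> cyclic_perms J. \<forall>i\<in>J. {i, p i} \<in> snd G}"
    then obtain vs where vs: "distinct vs" "set vs = J" "A = perm_arcs J (cycle_of_list vs)"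
      and e: "\<forall>(i, j)\<in>A. {i, j} \<in> snd G"
      by (auto simp: edges cyclic_perms_eq_cycles_of_lists[OF fin ne])
    then have "A = cyclic_arcs vs" using perm_arcs_cycle_of_list by metis
    moreover have "3 \<le> length vs" using J(2) vs distinct_card by metis
    ultimately show "A \<in> {A \<in> oriented_cycles G. Field A = J}"
      using vs e J(1) by (auto simp: oriented_cycles_def Field_cyclic_arcs)
  qed
qed

lemma adjacency_edgeI:
  assumes "i < dim_row M" "j < dim_row M" "i \<noteq> j" "M $$ (i, j) \<noteq> 0"
  shows "{i, j} \<in> snd (adjacency_graph M)"
  unfolding adjacency_graph_def snd_conv
  by (rule CollectI, rule exI[of _ i], rule exI[of _ j]) (simp add: assms)

text \<open>
  A cyclic permutation that uses a non-edge has a vanishing product, so only those along edges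
  of the adjacency graph contribute.
\<close>

lemma cyclic_sum_eq_sum_oriented_cycles:
  assumes J: "J \<subseteq> {..<dim_row M}" "3 \<le> card J"
  shows "cyclic_sum (\<lambda>i j. M $$ (i, j)) J =
    (\<Sum>A | A \<in> oriented_cycles (adjacency_graph M) \<and> Field A = J. \<Prod>(i, j)\<in>A. M $$ (i, j))"
proof -
  let ?E = "snd (adjacency_graph M)"
  let ?P = "{p \<in> cyclic_perms J. \<forall>i\<in>J. {i, p i} \<in> ?E}"
  have fin: "finite J" using J(2) card_ge_0_finite[of J] by auto
  have zero: "(\<Prod>i\<in>J. M $$ (i, p i)) = 0" if p: "p \<in> cyclic_perms J - ?P" for p
  proof -
    obtain i where i: "i \<in> J" "{i, p i} \<notin> ?E" and cyc: "cyclic_on p J"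
      using p by (auto simp: cyclic_perms_def)
    have pi: "p i \<in> J" "p i \<noteq> i"
      using eq_on_cyclic_on_iff1[OF cyc i(1)] J(2) by auto
    have "M $$ (i, p i) = 0"
    proof (rule ccontr)
      assume "M $$ (i, p i) \<noteq> 0"
      then have "{i, p i} \<in> ?E"
        using adjacency_edgeI[of i M "p i"] pi i(1) J(1) by (metis lessThan_iff subsetD)
      then show False using i(2) by contradiction
    qed
    then show ?thesis using i(1) fin by auto
  qed
  have "cyclic_sum (\<lambda>i j. M $$ (i, j)) J = (\<Sum>p\<in>?P. \<Prod>i\<in>J. M $$ (i, p i))"
    unfolding cyclic_sum_def
    by (rule sum.mono_neutral_right[OF finite_cyclic_perms[OF fin]]) (use zero in auto)
  also have "\<dots> = (\<Sum>p\<in>?P. \<Prod>(i, j)\<in>perm_arcs J p. M $$ (i, j))"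
    by (simp add: perm_arcs_def prod.reindex inj_on_def)
  also have "\<dots> = (\<Sum>A\<in>perm_arcs J ` ?P. \<Prod>(i, j)\<in>A. M $$ (i, j))"
    by (subst sum.reindex) (auto intro: inj_on_subset[OF inj_on_perm_arcs])
  also have "perm_arcs J ` ?P = {A \<in> oriented_cycles (adjacency_graph M). Field A = J}"
    using J by (intro oriented_cycles_on_vertex_set[symmetric]) (auto simp: adjacency_graph_def)
  finally show ?thesis .
qed

lemma Union_edges_eq_Field: "\<Union>{{i, j} | i j. (i, j) \<in> A} = Field A"
  by (auto simp: Field_def)

lemma Field_oriented_cycle:
  assumes "A \<in> oriented_cycles G"
  shows "Field A \<subseteq> fst G" "3 \<le> card (Field A)"
  using assms by (auto simp: oriented_cycles_def Field_cyclic_arcs distinct_card)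

text \<open>
  \<open>cycle_sum M C\<close> depends on \<open>C\<close> only through its vertex set, and equals the cyclic sum of that set.  A set of at
  least three vertices that carries no cycle has cyclic sum 0 for both matrices.
\<close>

lemma cycle_sums_eq_iff_cyclic_sums_eq:
  assumes dim: "dim_row H = N" "dim_row K = N"
    and graph: "adjacency_graph H = adjacency_graph K"
  shows "(\<forall>C\<in>cycles (adjacency_graph H). cycle_sum K C = cycle_sum H C) \<longleftrightarrow>
    (\<forall>J\<subseteq>{..<N}. 3 \<le> card J \<longrightarrow>
      cyclic_sum (\<lambda>i j. H $$ (i, j)) J = cyclic_sum (\<lambda>i j. K $$ (i, j)) J)" (is "?cycles \<longleftrightarrow> ?sums")
proof -
  let ?G = "adjacency_graph H"
  have cycle_sum: "cycle_sum M C = cyclic_sum (\<lambda>i j. M $$ (i, j)) (\<Union>C)"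
    if "adjacency_graph M = ?G" "dim_row M = N" "\<Union>C \<subseteq> {..<N}" "3 \<le> card (\<Union>C)" for M C
    using that by (simp add: cyclic_sum_eq_sum_oriented_cycles cycle_sum_def travelings_def)
  have vertices: "fst ?G = {..<N}" using dim by (simp add: adjacency_graph_def)
  show ?thesis
  proof
    assume cycles: ?cycles
    show ?sums
    proof (intro allI impI)
      fix J assume J: "J \<subseteq> {..<N}" "3 \<le> card J"
      show "cyclic_sum (\<lambda>i j. H $$ (i, j)) J = cyclic_sum (\<lambda>i j. K $$ (i, j)) J"
      proof (cases "\<exists>A\<in>oriented_cycles ?G. Field A = J")
        case True
        then obtain A where A: "A \<in> oriented_cycles ?G" "Field A = J" by blast
        let ?C = "{{i, j} | i j. (i, j) \<in> A}"
        have "?C \<in> cycles ?G" using A by (auto simp: cycles_def)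
        then have "cycle_sum K ?C = cycle_sum H ?C" using cycles by blast
        then show ?thesis
          using cycle_sum[of H ?C] cycle_sum[of K ?C] J A(2) dim graph
          unfolding Union_edges_eq_Field by simp
      next
        case False
        then have none: "{A \<in> oriented_cycles ?G. Field A = J} = {}" by blast
        then have "cyclic_sum (\<lambda>i j. M $$ (i, j)) J = 0"
          if "adjacency_graph M = ?G" "dim_row M = N" for M
          using J that by (simp only: cyclic_sum_eq_sum_oriented_cycles sum.empty)
        then show ?thesis using dim graph by simp
      qed
    qed
  next
    assume sums: ?sums
    show ?cycles
    proof
      fix C assume "C \<in> cycles ?G"
      then obtain A where A: "A \<in> oriented_cycles ?G" "\<Union>C = Field A"
        by (auto simp: cycles_def Union_edges_eq_Field)
      then have C: "\<Union>C \<subseteq> {..<N}" "3 \<le> card (\<Union>C)"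
        using Field_oriented_cycle[OF A(1)] vertices by auto
      then show "cycle_sum K C = cycle_sum H C"
        using cycle_sum[of H C] cycle_sum[of K C] sums dim graph by simp
    qed
  qed
qed

section \<open>Pairs of indices in signed kernels\<close>

lemma signed_kernel_transpose:
  assumes M: "M \<in> signed_kernels N" and ij: "i < N" "j < N" "i \<noteq> j"
  shows "M $$ (j, i) = M $$ (i, j) \<or> M $$ (j, i) = - M $$ (i, j)"
proof -
  obtain s :: real where "s \<in> {-1, 1}" "M $$ (j, i) = s * M $$ (i, j)"
    using M ij unfolding signed_kernels_def by blast
  then show ?thesis by auto
qed

text \<open>
  The product $M_{i,j} M_{j,i}$ is the edge sign times $|M_{i,j}|^2$.  Since the absolute values agree, the
  products agree iff the signs do.
\<close>

lemma signed_adjacency_graph_eq_iff: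
  assumes H: "H \<in> signed_kernels N" and K: "K \<in> signed_kernels N"
    and abs: "\<And>i j. i < N \<Longrightarrow> j < N \<Longrightarrow> i \<noteq> j \<Longrightarrow> \<bar>H $$ (i, j)\<bar> = \<bar>K $$ (i, j)\<bar>"
  shows "signed_adjacency_graph H = signed_adjacency_graph K \<longleftrightarrow>
    (\<forall>i<N. \<forall>j<N. i \<noteq> j \<longrightarrow> H $$ (i, j) * H $$ (j, i) = K $$ (i, j) * K $$ (j, i))"
    (is "?graphs \<longleftrightarrow> ?prods")
proof -
  have dim: "dim_row H = N" "dim_row K = N"
    using H K by (auto simp: signed_kernels_def)
  have edge: "H $$ (i, j) \<noteq> 0 \<longleftrightarrow> K $$ (i, j) \<noteq> 0" if "i < N" "j < N" "i \<noteq> j" for i j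
    using abs[OF that] by auto
  have sign_prod: "M $$ (i, j) * M $$ (j, i) = M $$ (j, i) / M $$ (i, j) * \<bar>M $$ (i, j)\<bar>\<^sup>2"
    if "M \<in> signed_kernels N" "i < N" "j < N" "i \<noteq> j" for M i j
    using signed_kernel_transpose[OF that] by (cases "M $$ (i, j) = 0") (auto simp: power2_eq_square)
  \<comment> \<open>The sign belongs to the unordered pair, so the set of signed edges is a function on edges.\<close>
  have sign_sym: "M $$ (j, i) / M $$ (i, j) = M $$ (i, j) / M $$ (j, i)"
    if "M \<in> signed_kernels N" "i < N" "j < N" "i \<noteq> j" for M i j
    using signed_kernel_transpose[OF that] by auto
  show ?thesis
  proof
    assume graphs: ?graphs
    show ?prods
    proof (intro allI impI)
      fix i j assume ij: "i < N" "j < N" "i \<noteq> j"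
      show "H $$ (i, j) * H $$ (j, i) = K $$ (i, j) * K $$ (j, i)"
      proof (cases "H $$ (i, j) = 0")
        case True
        then show ?thesis using edge[OF ij] by simp
      next
        case False
        then have "({i, j}, H $$ (j, i) / H $$ (i, j)) \<in> edge_signs H"
          using ij dim by (auto simp: edge_signs_def)
        then have "({i, j}, H $$ (j, i) / H $$ (i, j)) \<in> edge_signs K"
          using graphs by (simp add: signed_adjacency_graph_def)
        then have "H $$ (j, i) / H $$ (i, j) = K $$ (j, i) / K $$ (i, j)"
          using sign_sym[OF K ij] by (auto simp: edge_signs_def doubleton_eq_iff)
        then show ?thesis
          using sign_prod[OF H ij] sign_prod[OF K ij] abs[OF ij] by simp
      qed
    qed
  next
    assume prods: ?prods
    have "H $$ (j, i) / H $$ (i, j) = K $$ (j, i) / K $$ (i, j)" if "i < N" "j < N" "i \<noteq> j" for i j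
    proof (cases "H $$ (i, j) = 0")
      case True
      then show ?thesis using edge[OF that] by simp
    next
      case False
      have "H $$ (j, i) / H $$ (i, j) * \<bar>H $$ (i, j)\<bar>\<^sup>2 = K $$ (j, i) / K $$ (i, j) * \<bar>H $$ (i, j)\<bar>\<^sup>2"
        using sign_prod[OF H that] sign_prod[OF K that] prods that abs[OF that] by metis
      moreover have "\<bar>H $$ (i, j)\<bar>\<^sup>2 \<noteq> 0" using False by simp
      ultimately show ?thesis using mult_cancel_right by blast
    qed
    then have "edge_signs H = edge_signs K"
      using dim edge unfolding edge_signs_def by (intro Set.set_eqI iffI; clarsimp; metis)
    moreover have "adjacency_graph H = adjacency_graph K"
      using dim edge unfolding adjacency_graph_def by (auto; metis)
    ultimately show ?graphs by (simp add: signed_adjacency_graph_def)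
  qed
qed

lemma signed_kernel_abs_from_products:
  assumes H: "H \<in> signed_kernels N" and K: "K \<in> signed_kernels N"
    and ij: "i < N" "j < N" "i \<noteq> j"
    and prod: "H $$ (i, j) * H $$ (j, i) = K $$ (i, j) * K $$ (j, i)"
  shows "\<bar>H $$ (i, j)\<bar> = \<bar>K $$ (i, j)\<bar>"
proof -
  have "\<bar>M $$ (i, j) * M $$ (j, i)\<bar> = \<bar>M $$ (i, j)\<bar>\<^sup>2" if "M \<in> signed_kernels N" for M
    using signed_kernel_transpose[OF that ij] by (auto simp: abs_mult power2_eq_square)
  then have "\<bar>H $$ (i, j)\<bar>\<^sup>2 = \<bar>K $$ (i, j)\<bar>\<^sup>2"
    using prod H K by metis
  then show ?thesis by (rule power2_eq_imp_eq) simp_all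
qed

section \<open>Comparison of the cyclic sums by size\<close>

lemma nonempty_subsets_by_card:
  assumes "finite S"
  shows "(\<forall>J\<subseteq>S. J \<noteq> {} \<longrightarrow> P J) \<longleftrightarrow>
    (\<forall>i\<in>S. P {i}) \<and> (\<forall>i\<in>S. \<forall>j\<in>S. i \<noteq> j \<longrightarrow> P {i, j}) \<and> (\<forall>J\<subseteq>S. 3 \<le> card J \<longrightarrow> P J)"
    (is "?all \<longleftrightarrow> ?one \<and> ?two \<and> ?three")
proof
  assume ?all
  then show "?one \<and> ?two \<and> ?three" by auto
next
  assume R: "?one \<and> ?two \<and> ?three"
  show ?all
  proof (intro allI impI)
    fix J assume J: "J \<subseteq> S" "J \<noteq> {}"
    then have "card J \<noteq> 0" using assms finite_subset by fastforce
    then consider "card J = 1" | "card J = 2" | "3 \<le> card J" by linarith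
    then show "P J"
      using R J by cases (auto simp: card_1_singleton_iff card_2_iff)
  qed
qed

theorem theorem1:
  fixes N :: nat and H K :: "real mat"
  assumes "H \<in> signed_kernels N" and "K \<in> signed_kernels N"
  shows "(\<forall>J \<subseteq> {..<N}. det (submatrix H J J) = det (submatrix K J J)) \<longleftrightarrow>
    (\<forall>i<N. H $$ (i, i) = K $$ (i, i)) \<and>
    (\<forall>i<N. \<forall>j<N. i \<noteq> j \<longrightarrow> \<bar>H $$ (i, j)\<bar> = \<bar>K $$ (i, j)\<bar>) \<and>
    signed_adjacency_graph H = signed_adjacency_graph K \<and>
    (\<forall>C \<in> cycles (adjacency_graph H). cycle_sum K C = cycle_sum H C)"
proof -
  let ?h = "\<lambda>i j. H $$ (i, j)" and ?k = "\<lambda>i j. K $$ (i, j)"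
  let ?prods = "\<forall>i<N. \<forall>j<N. i \<noteq> j \<longrightarrow> ?h i j * ?h j i = ?k i j * ?k j i"
  let ?abs = "\<forall>i<N. \<forall>j<N. i \<noteq> j \<longrightarrow> \<bar>?h i j\<bar> = \<bar>?k i j\<bar>"
  let ?graphs = "signed_adjacency_graph H = signed_adjacency_graph K"
  let ?long = "\<forall>J\<subseteq>{..<N}. 3 \<le> card J \<longrightarrow> cyclic_sum ?h J = cyclic_sum ?k J"
  let ?cycles = "\<forall>C \<in> cycles (adjacency_graph H). cycle_sum K C = cycle_sum H C"
  have carrier: "H \<in> carrier_mat N N" "K \<in> carrier_mat N N"
    using assms by (auto simp: signed_kernels_def)
  have pairs: "?prods \<longleftrightarrow> ?abs \<and> ?graphs"
    using signed_kernel_abs_from_products[OF assms] signed_adjacency_graph_eq_iff[OF assms] by metis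
  have long: "?long \<longleftrightarrow> ?cycles" if ?graphs
    using cycle_sums_eq_iff_cyclic_sums_eq[of H N K] that carrier
    by (simp add: signed_adjacency_graph_def)
  have "(\<forall>J \<subseteq> {..<N}. det (submatrix H J J) = det (submatrix K J J)) \<longleftrightarrow>
      (\<forall>J\<subseteq>{..<N}. permutation_minor ?h J = permutation_minor ?k J)"
    using carrier by (simp add: det_principal_submatrix)
  also have "\<dots> \<longleftrightarrow> (\<forall>J\<subseteq>{..<N}. J \<noteq> {} \<longrightarrow> cyclic_sum ?h J = cyclic_sum ?k J)"
    by (rule permutation_minors_eq_iff_cyclic_sums_eq) simp
  also have "\<dots> \<longleftrightarrow> (\<forall>i<N. ?h i i = ?k i i) \<and> ?prods \<and> ?long"
    by (subst nonempty_subsets_by_card)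
       (simp_all add: cyclic_sum_singleton cyclic_sum_pair Ball_def)
  also have "\<dots> \<longleftrightarrow> (\<forall>i<N. ?h i i = ?k i i) \<and> ?abs \<and> ?graphs \<and> ?cycles"
    unfolding pairs using long by blast
  finally show ?thesis .
qed

end
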